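(* Let $E=\mathbf{F}_4$, let $\sigma$ be the nontrivial automorphism of $E$ (so $a^{\sigma}=a^2$), and let $A=E\oplus E=\{(a,b)\mid a,b\in E\}$ be the four-dimensional (non-associative) algebra over $\mathbf{F}_2$ with multiplication $$(a,b)(c,d)=(ac+b^{\sigma}d,\; bc+a^{\sigma}d+b^{\sigma}d^{\sigma}).$$ Let $x,y,x',y'\in A$ be nonzero. Write $x=(a,b)$, $y=(c,d)$, $x'=(a',b')$, $y'=(c',d')$ with $a,b,c,d,a',b',c',d'\in E$. Then $A(x,y)=A(x',y')$ if and only if one of the following holds: (i) $x=y$ and $x'=y'$. (ii) $x=x'$ and $y=y'$. (iii) $b=d=0$, $b'=d'=0$, and $c=ka$, $c'=ka'$ for some $k\in E^{\times}$. (iv) There exist $l,m,t\in E^{\times}$ such that $$a^{\sigma}=lb,\quad b^{\sigma}=la,\quad a'^{\sigma}=lb',\quad b'^{\sigma}=la',$$ $$c^{\sigma}=md,\quad d^{\sigma}=mc,\quad c'^{\sigma}=md',\quad d'^{\sigma}=mc',$$ $$c=ta,\quad d=tb,\quad c'=ta',\quad d'=tb'.$$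
   Context: For an algebra $A$ (a vector space with bilinear, not necessarily associative, multiplication) and $(x,y)\in A^2=A\oplus A$, let $A$ act on $A^2$ by $a(x,y)=(ax,ay)$ and put $A(x,y)=\{(ax,ay)\mid a\in A\}\subset A^2$. *)

theory Defs
  imports Complex_Main "HOL-Library.Z2" "HOL-Library.Product_Plus" "HOL-Library.Cardinality"
begin

text \<open>The field with four elements is an arbitrary type \<open>'e\<close> of class \<open>field\<close> with
  \<open>CARD('e) = 4\<close>; \<open>A = E \<oplus> E\<close> is \<open>'e \<times> 'e\<close> with componentwise addition.\<close>

definition field_automorphism :: "('e::field \<Rightarrow> 'e) \<Rightarrow> bool" where
  "field_automorphism \<sigma> \<longleftrightarrow>
     bij \<sigma> \<and> \<sigma> 1 = 1 \<and>
     (\<forall>a b. \<sigma> (a + b) = \<sigma> a + \<sigma> b) \<and> (\<forall>a b. \<sigma> (a * b) = \<sigma> a * \<sigma> b)"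

definition amult :: "('e::field \<Rightarrow> 'e) \<Rightarrow> 'e \<times> 'e \<Rightarrow> 'e \<times> 'e \<Rightarrow> 'e \<times> 'e" where
  "amult \<sigma> = (\<lambda>(a, b) (c, d). (a * c + \<sigma> b * d, b * c + \<sigma> a * d + \<sigma> b * \<sigma> d))"

text \<open>\<open>A(x,y)\<close> for an arbitrary algebra whose carrier is a whole type; only the
  multiplication enters.\<close>

definition pair_orbit :: "('a \<Rightarrow> 'a \<Rightarrow> 'a) \<Rightarrow> 'a \<Rightarrow> 'a \<Rightarrow> ('a \<times> 'a) set" where
  "pair_orbit mul x y = {(mul a x, mul a y) | a. True}"

text \<open>The remaining lemmas check that \<open>amult\<close> makes \<open>A\<close> an algebra with \<open>2\<^sup>4\<close> elements
  over the field \<open>bit\<close> with two elements.\<close>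

definition bit_scale :: "bit \<Rightarrow> 'a::zero \<Rightarrow> 'a" where
  "bit_scale k x = (if k = 0 then 0 else x)"

lemma add_self_eq_0:
  assumes "CARD('e::field) = 4"
  shows "(x::'e) + x = 0"
proof -
  have fin: "finite (UNIV :: 'e set)"
    using assms by (metis card.infinite zero_neq_numeral)
  have "bij (\<lambda>x::'e. x + 1)"
    by (rule bij_betw_byWitness[where f' = "\<lambda>x. x - 1"]) auto
  then have "(\<Sum>x::'e\<in>UNIV. x + 1) = (\<Sum>x::'e\<in>UNIV. x)"
    by (rule sum.reindex_bij_betw[where g = "\<lambda>x. x"])
  then have "(4::'e) = 0"
    using assms fin by (simp add: sum.distrib)
  moreover have "(4::'e) = 2 * 2"
    by simp
  ultimately have "(2::'e) = 0"
    by (metis mult_eq_0_iff)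
  then show ?thesis
    by (metis mult_2 mult_zero_left)
qed

lemma vector_space_bit_scale:
  assumes "CARD('e::field) = 4"
  shows "vector_space (bit_scale :: bit \<Rightarrow> 'e \<times> 'e \<Rightarrow> 'e \<times> 'e)"
proof
  fix k l :: bit and x y :: "'e \<times> 'e"
  show "bit_scale (k + l) x = bit_scale k x + bit_scale l x"
    by (cases k; cases l; cases x) (simp_all add: bit_scale_def add_self_eq_0[OF assms] zero_prod_def)
qed (auto simp: bit_scale_def)

lemma amult_bilinear:
  assumes "field_automorphism \<sigma>"
  shows "amult \<sigma> (x + x') y = amult \<sigma> x y + amult \<sigma> x' y"
    and "amult \<sigma> x (y + y') = amult \<sigma> x y + amult \<sigma> x y'"
    and "amult \<sigma> (bit_scale k x) y = bit_scale k (amult \<sigma> x y)"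
    and "amult \<sigma> x (bit_scale k y) = bit_scale k (amult \<sigma> x y)"
proof -
  have add: "\<sigma> (a + b) = \<sigma> a + \<sigma> b" for a b
    using assms by (simp add: field_automorphism_def)
  have zero: "\<sigma> 0 = 0"
    using add[of 0 0] by (metis add.right_neutral add_left_cancel)
  show "amult \<sigma> (x + x') y = amult \<sigma> x y + amult \<sigma> x' y"
    and "amult \<sigma> x (y + y') = amult \<sigma> x y + amult \<sigma> x y'"
    by (simp_all add: amult_def add algebra_simps split: prod.splits)
  show "amult \<sigma> (bit_scale k x) y = bit_scale k (amult \<sigma> x y)"
    and "amult \<sigma> x (bit_scale k y) = bit_scale k (amult \<sigma> x y)"
    by (simp_all add: amult_def bit_scale_def zero zero_prod_def split: prod.splits)
qed

lemma card_algebra: "CARD('e) = 4 \<Longrightarrow> CARD('e \<times> 'e) = 2 ^ 4"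
  by simp

end

theory Submission
  imports Defs
begin

text \<open>
  Right multiplication \<open>R\<^sub>x\<close> by a nonzero \<open>x\<close> is bijective, because \<open>A\<close> has no zero divisors.
  Hence \<open>A(x,y)\<close> is the graph of the additive map \<open>T = R\<^sub>y R\<^sub>x\<^sup>-\<^sup>1\<close>, and \<open>A(x,y) = A(x',y')\<close>
  says exactly that \<open>T R\<^sub>x = R\<^sub>y\<close> and \<open>T R\<^sub>x\<^sub>' = R\<^sub>y\<^sub>'\<close> for one map \<open>T\<close>. So the question is
  which maps \<open>T\<close> carry more than one right multiplication to a right multiplication.

  Every additive map of \<open>E\<^sup>2\<close> has a unique form \<open>z \<mapsto> T\<^sub>0 z + T\<^sub>1 z\<^sup>\<sigma>\<close> with two matrices over \<open>E\<close>
  (lemma \<open>additive_imp_semilinear_map\<close>). Comparing coefficients turns \<open>T R\<^sub>x = R\<^sub>y\<close> into eight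
  equations over \<open>E\<close> (lemma \<open>intertwines_coeffs\<close>). When they hold for two distinct nonzero
  \<open>x = (a,b)\<close> and \<open>x' = (a',b')\<close>, there are only two possibilities (lemma
  \<open>intertwines_dichotomy\<close>). Either \<open>T\<close> is multiplication by a scalar \<open>p \<in> E\<close>; the last of the
  eight equations, with \<open>y \<noteq> 0\<close>, then forces \<open>p = 1\<close> unless \<open>b = b' = 0\<close>, which gives cases (i) and (iii). Or \<open>x\<close>
  and \<open>x'\<close> lie in the same plane \<open>{(a, b). a\<^sup>2 = l b}\<close> over the prime field, for some
  \<open>l \<noteq> 0\<close>, and \<open>y = t x\<close>, \<open>y' = t x'\<close> with the same scalar \<open>t\<close>, which is case (iv).
  If \<open>x = x'\<close>, then \<open>y = T x = T x' = y'\<close>, because \<open>(1, 0)\<close> is a left identity of \<open>A\<close>; this is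
  case (ii).

  For the converse, case (ii) is immediate. In the other cases \<open>T\<close> can be written down, and it depends only on the data common to
  the two sides: it is the identity in case (i), multiplication by \<open>k\<close> in case (iii), and
  \<open>(u, l\<^sup>2 u\<^sup>2 + w) \<mapsto> (t u, t l\<^sup>2 u\<^sup>2 + t\<^sup>2 w)\<close> in case (iv).
\<close>

text \<open>The map \<open>z \<mapsto> T\<^sub>0 z + T\<^sub>1 z\<^sup>\<sigma>\<close> of \<open>E\<^sup>2\<close>, where \<open>T\<^sub>0\<close> has the rows \<open>(p, q)\<close>, \<open>(r, s)\<close> and \<open>T\<^sub>1\<close> has the
  rows \<open>(P, Q)\<close>, \<open>(R, S)\<close>; squaring is \<open>\<sigma>\<close>.\<close>

definition semilinear_map :: "'e::field \<Rightarrow> 'e \<Rightarrow> 'e \<Rightarrow> 'e \<Rightarrow> 'e \<Rightarrow> 'e \<Rightarrow> 'e \<Rightarrow> 'e \<Rightarrow> 'e \<times> 'e \<Rightarrow> 'e \<times> 'e" where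
  "semilinear_map p q r s P Q R S = (\<lambda>(u, w).
     (p * u + q * w + P * u\<^sup>2 + Q * w\<^sup>2, r * u + s * w + R * u\<^sup>2 + S * w\<^sup>2))"

text \<open>The equation \<open>T R\<^sub>x = R\<^sub>y\<close> between the right multiplications.\<close>

definition intertwines :: "('a \<Rightarrow> 'a \<Rightarrow> 'a) \<Rightarrow> ('a \<Rightarrow> 'a) \<Rightarrow> 'a \<Rightarrow> 'a \<Rightarrow> bool" where
  "intertwines mul T x y \<longleftrightarrow> (\<forall>v. T (mul v x) = mul v y)"

context
  fixes \<sigma> :: "'e::field \<Rightarrow> 'e"
  assumes card4: "CARD('e) = 4" and aut: "field_automorphism \<sigma>" and nontriv: "\<sigma> \<noteq> id"
begin

section \<open>The field with four elements\<close>

lemma double_zero [simp]: "(z::'e) + z = 0" "z + (z + u) = u"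
  using add_self_eq_0[OF card4, of z] by (simp_all flip: add.assoc)

lemma sum_eq_0_iff: "(z::'e) + u = 0 \<longleftrightarrow> z = u"
  by (metis add.right_neutral double_zero)

lemma primitive_element:
  obtains w :: 'e where "w \<noteq> 0" "w \<noteq> 1" "w\<^sup>2 = w + 1" "\<forall>z. z \<in> {0, 1, w, w + 1}"
proof -
  have fin: "finite (UNIV :: 'e set)"
    using card4 by (metis card.infinite zero_neq_numeral)
  have "\<not> (UNIV :: 'e set) \<subseteq> {0, 1}"
    using card_mono[of "{0, 1}" "UNIV :: 'e set"] card4 by auto
  then obtain w :: 'e where w: "w \<noteq> 0" "w \<noteq> 1" by blast
  have distinct: "w + 1 \<noteq> 0" "w + 1 \<noteq> 1" "w + 1 \<noteq> w"
    using w sum_eq_0_iff[of w 1] by simp_all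
  have "card {0, 1, w, w + 1} = CARD('e)"
    using w distinct distinct[symmetric] card4 by simp
  then have U: "{0, 1, w, w + 1} = (UNIV :: 'e set)"
    using fin by (simp add: card_subset_eq)
  have "w\<^sup>2 \<noteq> 0" "w\<^sup>2 \<noteq> w"
    using w by (auto simp: power2_eq_square)
  moreover have "w\<^sup>2 \<noteq> 1"
  proof
    assume "w\<^sup>2 = 1"
    then have "(w + 1) * (w + 1) = 0"
      by (simp add: algebra_simps power2_eq_square)
    then show False using distinct by simp
  qed
  ultimately have "w\<^sup>2 = w + 1" using U by (metis UNIV_I empty_iff insert_iff)
  then show ?thesis using that[of w] w U by blast
qed

lemma square_add: "((z::'e) + u)\<^sup>2 = z\<^sup>2 + u\<^sup>2"
proof -
  have "(z + u)\<^sup>2 = (z\<^sup>2 + u\<^sup>2) + (z * u + z * u)"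
    by (simp only: power2_eq_square distrib_left distrib_right ac_simps)
  then show ?thesis by (simp only: double_zero(1) add_0_right)
qed

text \<open>The group of units has order three. In computations this makes \<open>z\<^sup>2\<close> the inverse of \<open>z\<close>, which
  avoids division throughout.\<close>

lemma cube_eq_1:
  assumes "(z::'e) \<noteq> 0" shows "z * z\<^sup>2 = 1"
proof -
  obtain w :: 'e where w: "w \<noteq> 0" "w \<noteq> 1" "w\<^sup>2 = w + 1" "\<forall>z. z \<in> {0, 1, w, w + 1}"
    using primitive_element by blast
  have "w * w = w + 1" using w(3) by (simp add: power2_eq_square)
  then have "w * (w + 1) = 1"
    by (simp only: distrib_left mult_1_right add.assoc[of w] add.commute[of 1] double_zero(2))
  moreover have "(w + 1)\<^sup>2 = w"
    by (simp only: square_add w(3) power_one add.assoc double_zero(1) add_0_right)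
  moreover have "z = 1 \<or> z = w \<or> z = w + 1"
    using assms spec[OF w(4), of z] by blast
  ultimately show ?thesis
    by (metis w(3) mult.commute mult_1 power_one)
qed

lemma square_square [simp]: "((z::'e)\<^sup>2)\<^sup>2 = z"
proof (cases "z = 0")
  case False
  have "(z\<^sup>2)\<^sup>2 = z * (z * z\<^sup>2)" by (simp add: power2_eq_square)
  then show ?thesis by (simp only: cube_eq_1[OF False] mult_1_right)
qed simp

lemma power4_eq_self [simp]: "(z::'e) ^ 4 = z"
  using square_square[of z] by (simp only: power4_eq_xxxx power2_eq_square mult.assoc)

lemma square_eq_self: "(z::'e)\<^sup>2 = z \<Longrightarrow> z \<noteq> 0 \<Longrightarrow> z = 1"
  unfolding power2_eq_square by (metis mult_cancel_left1)

text \<open>An automorphism fixes the prime field, so a nontrivial one has to exchange the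
  other two elements \<open>w\<close> and \<open>w + 1 = w\<^sup>2\<close>.\<close>

lemma \<sigma>_square: "\<sigma> z = z\<^sup>2"
proof -
  obtain w :: 'e where w: "w \<noteq> 0" "w \<noteq> 1" "w\<^sup>2 = w + 1" "\<forall>z. z \<in> {0, 1, w, w + 1}"
    using primitive_element by blast
  have add: "\<sigma> (z + u) = \<sigma> z + \<sigma> u" and one: "\<sigma> 1 = 1" and inj: "\<sigma> z = \<sigma> u \<longleftrightarrow> z = u" for z u
    using aut by (auto simp: field_automorphism_def bij_def inj_def)
  have zero: "\<sigma> 0 = 0" using add[of 0 0] by simp
  have "\<sigma> w \<noteq> w"
  proof
    assume "\<sigma> w = w"
    then have "\<sigma> z = z" for z using spec[OF w(4), of z] by (auto simp: add one zero)
    then show False using nontriv by auto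
  qed
  moreover have "\<sigma> w \<noteq> 0" "\<sigma> w \<noteq> 1" using w inj[of w 0] inj[of w 1] zero one by auto
  ultimately have "\<sigma> w = w + 1" using spec[OF w(4), of "\<sigma> w"] by auto
  then show ?thesis
    using spec[OF w(4), of z] by (auto simp: add one zero w(3) square_add)
qed

section \<open>Right multiplications and orbits as graphs\<close>

lemma amult_pair:
  "amult \<sigma> (a, b) (c, d) = (a * c + b\<^sup>2 * d, b * c + a\<^sup>2 * d + b\<^sup>2 * d\<^sup>2)"
  by (simp add: amult_def \<sigma>_square)

lemma amult_one: "amult \<sigma> (1, 0) y = y"
  by (cases y) (simp add: amult_pair)

text \<open>Let \<open>v = (a, b)\<close> annihilate \<open>x = (c, d)\<close> with \<open>d \<noteq> 0\<close>. Eliminating \<open>c\<close> from the two coordinates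
  gives \<open>a\<^sup>3 + b\<^sup>3 + a b\<^sup>2 d = 0\<close>. As cubes are \<open>0\<close> or \<open>1\<close>, this is \<open>1 = 0\<close> if exactly one of \<open>a\<close>, \<open>b\<close>
  vanishes, and \<open>a b\<^sup>2 d = 0\<close> if neither does.\<close>

lemma amult_eq_0:
  assumes "amult \<sigma> v x = 0" "x \<noteq> 0" shows "v = 0"
proof -
  obtain a b c d where v: "v = (a, b)" and x: "x = (c, d)" by (metis surj_pair)
  have 1: "a * c = b\<^sup>2 * d" and 2: "b * c + a\<^sup>2 * d + b\<^sup>2 * d\<^sup>2 = 0"
    using assms by (auto simp: v x amult_pair zero_prod_def sum_eq_0_iff)
  have "a = 0 \<and> b = 0"
  proof (cases "d = 0")
    case True
    then show ?thesis using 1 2 assms by (auto simp: x zero_prod_def)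
  next
    case d: False
    have "b = 0" if "a = 0" using 1 d that by simp
    moreover have False if "a \<noteq> 0"
    proof -
      have "(b * b\<^sup>2 + a * a\<^sup>2 + a * b\<^sup>2 * d) * d = b * (b\<^sup>2 * d) + a * (a\<^sup>2 * d + b\<^sup>2 * d\<^sup>2)"
        by (simp add: power2_eq_square algebra_simps)
      also have "\<dots> = a * (b * c + a\<^sup>2 * d + b\<^sup>2 * d\<^sup>2)"
        unfolding 1[symmetric] by (simp add: algebra_simps)
      finally have "b * b\<^sup>2 + a * a\<^sup>2 + a * b\<^sup>2 * d = 0"
        using 2 d by simp
      then show False
        using that d cube_eq_1[of a] cube_eq_1[of b] by (cases "b = 0") auto
    qed
    ultimately show ?thesis by blast
  qed
  then show ?thesis by (simp add: v zero_prod_def)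
qed

lemma bij_right_mult:
  assumes "x \<noteq> 0" shows "bij (\<lambda>v. amult \<sigma> v x)"
proof -
  note add = amult_bilinear(1)[OF aut]
  have "finite (UNIV :: 'e set)"
    using card4 by (metis card.infinite zero_neq_numeral)
  then have "finite (UNIV :: ('e \<times> 'e) set)"
    by (simp add: finite_prod)
  moreover have "inj (\<lambda>v. amult \<sigma> v x)"
  proof (rule injI)
    fix v v' assume eq: "amult \<sigma> v x = amult \<sigma> v' x"
    have "amult \<sigma> v x = amult \<sigma> (v - v') x + amult \<sigma> v' x"
      using add[of "v - v'" v' x] by simp
    then show "v = v'" using eq amult_eq_0[OF _ assms, of "v - v'"] by simp
  qed
  ultimately show ?thesis
    by (simp add: bij_def finite_UNIV_inj_surj)
qed

text \<open>The map is \<open>R\<^sub>y R\<^sub>x\<^sup>-\<^sup>1\<close>.\<close>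

lemma pair_orbit_graph:
  assumes "x \<noteq> 0"
  shows "\<exists>T. (\<forall>z u. T (z + u) = T z + T u) \<and> pair_orbit (amult \<sigma>) x y = {(z, T z) | z. True}"
proof -
  define D where "D = inv (\<lambda>v. amult \<sigma> v x)"
  note bij = bij_right_mult[OF assms]
  have D: "amult \<sigma> (D z) x = z" "D (amult \<sigma> v x) = v" for z v
    using bij surj_f_inv_f[OF bij_is_surj[OF bij]] inv_f_f[OF bij_is_inj[OF bij]] by (auto simp: D_def)
  have Dadd: "D (z + u) = D z + D u" for z u
    by (metis D amult_bilinear(1)[OF aut])
  show ?thesis
  proof (intro exI[of _ "\<lambda>z. amult \<sigma> (D z) y"] conjI allI)
    show "amult \<sigma> (D (z + u)) y = amult \<sigma> (D z) y + amult \<sigma> (D u) y" for z u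
      by (simp add: Dadd amult_bilinear(1)[OF aut])
    show "pair_orbit (amult \<sigma>) x y = {(z, amult \<sigma> (D z) y) | z. True}"
      unfolding pair_orbit_def by (metis (no_types, lifting) D)
  qed
qed

section \<open>Additive maps in coordinates\<close>

text \<open>An additive map is determined by its values at \<open>1\<close> and at one element \<open>w \<noteq> 0, 1\<close>, and these two values can be
  prescribed by the choice of \<open>\<alpha>\<close> and \<open>\<beta>\<close>.\<close>

lemma additive_imp_semilinear:
  fixes f :: "'e \<Rightarrow> 'e"
  assumes add: "\<And>z u. f (z + u) = f z + f u"
  obtains \<alpha> \<beta> where "\<And>z. f z = \<alpha> * z + \<beta> * z\<^sup>2"
proof -
  obtain w :: 'e where w: "w \<noteq> 0" "w \<noteq> 1" "w\<^sup>2 = w + 1" "\<forall>z. z \<in> {0, 1, w, w + 1}"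
    using primitive_element by blast
  define \<beta> where "\<beta> = f w + w * f 1"
  have zero: "f 0 = 0" using add[of 0 0] by simp
  have "f z = (f 1 + \<beta>) * z + \<beta> * z\<^sup>2" for z
    using spec[OF w(4), of z] by (auto simp: zero add w(3) square_add \<beta>_def algebra_simps)
  then show ?thesis using that by blast
qed

lemma semilinear_eqD:
  fixes \<alpha> \<beta> \<gamma> \<delta> :: 'e
  assumes "\<And>z. \<alpha> * z + \<beta> * z\<^sup>2 = \<gamma> * z + \<delta> * z\<^sup>2"
  shows "\<alpha> = \<gamma>" "\<beta> = \<delta>"
proof -
  obtain w :: 'e where w: "w \<noteq> 0" "w \<noteq> 1" "w\<^sup>2 = w + 1" "\<forall>z. z \<in> {0, 1, w, w + 1}"
    using primitive_element by blast
  have 1: "\<alpha> + \<beta> = \<gamma> + \<delta>" using assms[of 1] by simp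
  have "(\<alpha> + \<beta>) * w + \<beta> = (\<gamma> + \<delta>) * w + \<delta>"
    using assms[of w] by (simp add: w(3) algebra_simps)
  then show "\<beta> = \<delta>" by (simp add: 1)
  then show "\<alpha> = \<gamma>" using 1 by simp
qed

lemma additive_imp_semilinear_map:
  fixes T :: "'e \<times> 'e \<Rightarrow> 'e \<times> 'e"
  assumes add: "\<And>z u. T (z + u) = T z + T u"
  obtains p q r s P Q R S where "T = semilinear_map p q r s P Q R S"
proof -
  have 1: "fst (T (u + w, 0)) = fst (T (u, 0)) + fst (T (w, 0))"
    "snd (T (u + w, 0)) = snd (T (u, 0)) + snd (T (w, 0))"
    "fst (T (0, u + w)) = fst (T (0, u)) + fst (T (0, w))"
    "snd (T (0, u + w)) = snd (T (0, u)) + snd (T (0, w))" for u w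
    using add[of "(u, 0)" "(w, 0)"] add[of "(0, u)" "(0, w)"] by auto
  obtain p P where "\<And>u. fst (T (u, 0)) = p * u + P * u\<^sup>2"
    using additive_imp_semilinear[of "\<lambda>u. fst (T (u, 0))"] 1 by blast
  moreover obtain q Q where "\<And>w. fst (T (0, w)) = q * w + Q * w\<^sup>2"
    using additive_imp_semilinear[of "\<lambda>w. fst (T (0, w))"] 1 by blast
  moreover obtain r R where "\<And>u. snd (T (u, 0)) = r * u + R * u\<^sup>2"
    using additive_imp_semilinear[of "\<lambda>u. snd (T (u, 0))"] 1 by blast
  moreover obtain s S where "\<And>w. snd (T (0, w)) = s * w + S * w\<^sup>2"
    using additive_imp_semilinear[of "\<lambda>w. snd (T (0, w))"] 1 by blast
  ultimately have "T (u, w) = semilinear_map p q r s P Q R S (u, w)" for u w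
    using add[of "(u, 0)" "(0, w)"] unfolding semilinear_map_def prod_eq_iff
    by (simp add: ac_simps)
  then have "T = semilinear_map p q r s P Q R S" by auto
  then show ?thesis using that by blast
qed

text \<open>Evaluate \<open>T (v x) = v y\<close> at \<open>v = (z, 0)\<close> and \<open>v = (0, z)\<close>. Each of the four coordinates is of the
  form \<open>\<alpha> z + \<beta> z\<^sup>2\<close> on both sides, and yields two equations.\<close>

lemma intertwines_coeffs:
  assumes "intertwines (amult \<sigma>) (semilinear_map p q r s P Q R S) (a, b) (c, d)"
  shows "c = p * a + Q * b\<^sup>2" "q * b + P * a\<^sup>2 = 0" "r * a + S * b\<^sup>2 = 0" "d = s * b + R * a\<^sup>2"
    "q * a + P * b\<^sup>2 + Q * b = 0" "d = p * b + q * b\<^sup>2 + Q * a\<^sup>2"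
    "c = s * a + R * b\<^sup>2 + S * b" "d\<^sup>2 = r * b + s * b\<^sup>2 + S * a\<^sup>2"
proof -
  note unique = semilinear_eqD
  note simps = amult_pair semilinear_map_def square_add power_mult_distrib algebra_simps
  have v0: "semilinear_map p q r s P Q R S (amult \<sigma> (v, 0) (a, b)) = amult \<sigma> (v, 0) (c, d)"
   and v1: "semilinear_map p q r s P Q R S (amult \<sigma> (0, v) (a, b)) = amult \<sigma> (0, v) (c, d)" for v
    using assms unfolding intertwines_def by blast+
  have "(p * a + Q * b\<^sup>2) * v + (q * b + P * a\<^sup>2) * v\<^sup>2 = c * v + 0 * v\<^sup>2" for v
    using v0[of v] by (simp add: simps)
  from unique[OF this] show "c = p * a + Q * b\<^sup>2" "q * b + P * a\<^sup>2 = 0" by auto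
  have "(r * a + S * b\<^sup>2) * v + (s * b + R * a\<^sup>2) * v\<^sup>2 = 0 * v + d * v\<^sup>2" for v
    using v0[of v] by (simp add: simps)
  from unique[OF this] show "r * a + S * b\<^sup>2 = 0" "d = s * b + R * a\<^sup>2" by auto
  have "(q * a + P * b\<^sup>2 + Q * b) * v + (p * b + q * b\<^sup>2 + Q * a\<^sup>2) * v\<^sup>2 = 0 * v + d * v\<^sup>2" for v
    using v1[of v] by (simp add: simps)
  from unique[OF this] show "q * a + P * b\<^sup>2 + Q * b = 0" "d = p * b + q * b\<^sup>2 + Q * a\<^sup>2" by auto
  have "(s * a + R * b\<^sup>2 + S * b) * v + (r * b + s * b\<^sup>2 + S * a\<^sup>2) * v\<^sup>2 = c * v + d\<^sup>2 * v\<^sup>2" for v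
    using v1[of v] by (simp add: simps)
  from unique[OF this] show "c = s * a + R * b\<^sup>2 + S * b" "d\<^sup>2 = r * b + s * b\<^sup>2 + S * a\<^sup>2" by auto
qed

section \<open>Maps that intertwine two right multiplications\<close>

text \<open>Off both axes the equations determine the matrix of \<open>T\<close> in terms of few parameters, and \<open>a\<close>, \<open>b\<close>
  enter almost only through \<open>l = (a b)\<^sup>2\<close>. This \<open>l\<close> is the factor with \<open>a\<^sup>2 = l b\<close> and
  \<open>b\<^sup>2 = l a\<close>, that is, the parameter of the plane that contains \<open>(a, b)\<close>.\<close>

lemma intertwines_coeffs_off_axes:
  assumes T: "intertwines (amult \<sigma>) (semilinear_map p q r s P Q R S) (a, b) (c, d)"
    and a: "a \<noteq> 0" and b: "b \<noteq> 0"
  defines "l \<equiv> (a * b)\<^sup>2"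
  shows "Q = 0" "q = P * l" "r = S * l" "p = s + R * l + S * (a * b * a)" "p + q * b = s + R * l"
proof -
  note e = intertwines_coeffs[OF T]
  note cubes = cube_eq_1[OF a] cube_eq_1[OF b]
  have qb: "q * b = P * a\<^sup>2" and ra: "r * a = S * b\<^sup>2"
    using e(2,3) by (simp_all only: sum_eq_0_iff)
  have "0 = (q * a + P * b\<^sup>2 + Q * b) * b" by (simp add: e(5))
  also have "\<dots> = (q * b) * a + P * (b * b\<^sup>2) + Q * b\<^sup>2"
    by (simp add: algebra_simps power2_eq_square)
  also have "\<dots> = P * (a * a\<^sup>2) + P * (b * b\<^sup>2) + Q * b\<^sup>2"
    unfolding qb by (simp only: ac_simps)
  also have "\<dots> = Q * b\<^sup>2" by (simp only: cubes) simp
  finally show Q: "Q = 0" using b by simp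
  have "q = q * (b * b\<^sup>2)" by (simp only: cubes mult_1_right)
  also have "\<dots> = (q * b) * b\<^sup>2" by (simp only: mult.assoc)
  finally show "q = P * l" by (simp add: qb l_def power_mult_distrib mult.assoc)
  have "r = r * (a * a\<^sup>2)" by (simp only: cubes mult_1_right)
  also have "\<dots> = (r * a) * a\<^sup>2" by (simp only: mult.assoc)
  also have "\<dots> = S * l" unfolding ra by (simp only: l_def power_mult_distrib ac_simps)
  finally show "r = S * l" .
  have "p = p * (a * a\<^sup>2)" by (simp only: cubes mult_1_right)
  also have "\<dots> = (s * a + R * b\<^sup>2 + S * b) * a\<^sup>2"
    using e(1,7) by (simp add: Q flip: mult.assoc)
  also have "\<dots> = s * (a * a\<^sup>2) + R * l + S * (a * b * a)"
    by (simp add: l_def algebra_simps power2_eq_square)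
  finally show "p = s + R * l + S * (a * b * a)" by (simp only: cubes mult_1_right)
  have "p + q * b = p * (b * b\<^sup>2) + q * b * (b * b\<^sup>2)" by (simp only: cubes mult_1_right)
  also have "\<dots> = (p * b + q * b\<^sup>2) * b\<^sup>2" by (simp add: algebra_simps power2_eq_square)
  also have "\<dots> = (s * b + R * a\<^sup>2) * b\<^sup>2" using e(4,6) by (simp add: Q)
  also have "\<dots> = s * (b * b\<^sup>2) + R * l" by (simp add: l_def algebra_simps power2_eq_square)
  finally show "p + q * b = s + R * l" by (simp only: cubes mult_1_right)
qed

text \<open>The point \<open>(a, 0)\<close> alone leaves two free parameters, namely \<open>p\<close> and \<open>R\<close>, with \<open>Q = R\<close> and
  \<open>S = R\<^sup>2 a\<^sup>2\<close>. Any second point \<open>(a', b')\<close> forces \<open>R = 0\<close>: through the equation \<open>Q b' = 0\<close> if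
  \<open>b' \<noteq> 0\<close>, and otherwise because \<open>S\<close> also equals \<open>R\<^sup>2 a'\<^sup>2\<close>.\<close>

lemma intertwines_axis_imp_scalar:
  assumes T: "intertwines (amult \<sigma>) (semilinear_map p q r s P Q R S) (a, 0) (c, d)"
    and T': "intertwines (amult \<sigma>) (semilinear_map p q r s P Q R S) (a', b') (c', d')"
    and a: "a \<noteq> 0" and indep: "(a', b') \<noteq> (0, 0)" "(a', b') \<noteq> (a, 0)"
  shows "semilinear_map p q r s P Q R S = semilinear_map p 0 0 p 0 0 0 0"
proof -
  note e = intertwines_coeffs[OF T] and e' = intertwines_coeffs[OF T']
  have 1: "q = 0" "r = 0" "P = 0" "s = p" using e a by auto
  have Ra: "R * a\<^sup>2 = d" "Q * a\<^sup>2 = d" using e a by auto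
  then have QR: "Q = R" using a by (metis mult_cancel_right power_not_zero)
  have "S * a\<^sup>2 = d\<^sup>2" using e a 1 by auto
  also have "\<dots> = R\<^sup>2 * a * (a * a\<^sup>2)"
    by (simp add: power_mult_distrib cube_eq_1[OF a] flip: Ra(1))
  also have "\<dots> = R\<^sup>2 * a\<^sup>2 * a\<^sup>2" by (simp add: power2_eq_square)
  finally have S: "S = R\<^sup>2 * a\<^sup>2" using a by simp
  have "R = 0"
  proof (cases "b' = 0")
    case False
    then show ?thesis using e'(5) by (simp add: 1 QR)
  next
    case b': True
    then have a': "a' \<noteq> 0" "a' \<noteq> a" using indep by auto
    have "R * a'\<^sup>2 = d'" using e'(4) b' by simp
    have "S * a'\<^sup>2 = d'\<^sup>2" using e'(8) b' by simp
    also have "\<dots> = R\<^sup>2 * a' * (a' * a'\<^sup>2)"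
      by (simp add: power_mult_distrib cube_eq_1[OF a'(1)] flip: \<open>R * a'\<^sup>2 = d'\<close>)
    also have "\<dots> = R\<^sup>2 * a'\<^sup>2 * a'\<^sup>2" by (simp add: power2_eq_square)
    finally have "S = R\<^sup>2 * a'\<^sup>2" using a' by simp
    then have "R = 0 \<or> a\<^sup>2 = a'\<^sup>2" using S by simp
    moreover have "a\<^sup>2 \<noteq> a'\<^sup>2" using a'(2) by (metis square_square)
    ultimately show ?thesis by blast
  qed
  then show ?thesis by (simp add: 1 QR S)
qed

lemma intertwines_add:
  assumes "intertwines (amult \<sigma>) (semilinear_map p q r s P Q R S) x y"
    and "intertwines (amult \<sigma>) (semilinear_map p q r s P Q R S) x' y'"
  shows "intertwines (amult \<sigma>) (semilinear_map p q r s P Q R S) (x + x') (y + y')"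
proof -
  have "semilinear_map p q r s P Q R S (z + z') =
      semilinear_map p q r s P Q R S z + semilinear_map p q r s P Q R S z'" for z z'
    by (cases z; cases z') (simp add: semilinear_map_def square_add algebra_simps)
  then show ?thesis
    using assms by (simp add: intertwines_def amult_bilinear(2)[OF aut])
qed

text \<open>The multiplication contains the term \<open>b\<^sup>\<sigma> d\<^sup>\<sigma>\<close>, which a scalar \<open>p\<close> outside the prime field does
  not respect.\<close>

lemma scalar_intertwines:
  assumes T: "intertwines (amult \<sigma>) (semilinear_map p 0 0 p 0 0 0 0) (a, b) (c, d)"
  shows "c = p * a" "d = p * b" "b \<noteq> 0 \<Longrightarrow> p = 0 \<or> p = 1"
proof -
  note e = intertwines_coeffs[OF T]
  show "c = p * a" "d = p * b" using e by auto
  have "p\<^sup>2 * b\<^sup>2 = p * b\<^sup>2" using e(4,8) by (simp add: power_mult_distrib)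
  then show "p = 0 \<or> p = 1" if "b \<noteq> 0"
    using that square_eq_self[of p] by auto
qed

text \<open>If \<open>a\<close> or \<open>a'\<close> vanishes, the equations are strong enough to make \<open>T\<close> scalar. Otherwise
  \<open>q = P l\<close>, \<open>r = S l\<close> and \<open>p + q b = s + R l\<close> hold for \<open>l = (a b)\<^sup>2\<close> and also with
  \<open>(a' b')\<^sup>2\<close> and \<open>b'\<close>. If these two values of \<open>l\<close> differ, \<open>T\<close> is scalar again. If they agree,
  comparing the two expressions for \<open>p\<close> gives \<open>S = 0\<close>, and then \<open>q = 0\<close>, so that \<open>T\<close> multiplies
  both points by \<open>p\<close>.\<close>

lemma intertwines_off_axis:
  assumes T: "intertwines (amult \<sigma>) (semilinear_map p q r s P Q R S) (a, b) (c, d)"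
    and T': "intertwines (amult \<sigma>) (semilinear_map p q r s P Q R S) (a', b') (c', d')"
    and b: "b \<noteq> 0" "b' \<noteq> 0" "b \<noteq> b'"
    and nonscalar: "semilinear_map p q r s P Q R S \<noteq> semilinear_map p 0 0 p 0 0 0 0"
  shows "a \<noteq> 0" "a' \<noteq> 0" "(a * b)\<^sup>2 = (a' * b')\<^sup>2"
    "c = p * a" "d = p * b" "c' = p * a'" "d' = p * b'"
proof -
  note e = intertwines_coeffs[OF T] and e' = intertwines_coeffs[OF T']
  \<comment> \<open>Stated for arbitrary points, since it is needed with the two points in either order.\<close>
  have mixed: "semilinear_map p q r s P Q R S = semilinear_map p 0 0 p 0 0 0 0"
    if T: "intertwines (amult \<sigma>) (semilinear_map p q r s P Q R S) (0, b) (c, d)"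
      and T': "intertwines (amult \<sigma>) (semilinear_map p q r s P Q R S) (a', b') (c', d')"
      and nz: "b \<noteq> 0" "b' \<noteq> 0" "a' \<noteq> 0" for b c d a' b' c' d'
  proof -
    note e = intertwines_coeffs[OF T] and off = intertwines_coeffs_off_axes[OF T' nz(3,2)]
    have "S = 0" "q = 0" using e nz by auto
    moreover have "P = 0" using e off(1) nz by auto
    moreover have "r = 0" using off(3) \<open>S = 0\<close> by simp
    moreover have "R = 0" using e off(1) nz \<open>S = 0\<close> by auto
    moreover have "p = s" using off(5) \<open>R = 0\<close> \<open>q = 0\<close> by simp
    ultimately show ?thesis by (simp add: off(1))
  qed
  have vertical: "semilinear_map p q r s P Q R S = semilinear_map p 0 0 p 0 0 0 0"
    if "a = 0" "a' = 0"
  proof -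
    have 1: "S = 0" "q = 0" using e that b by auto
    have "P * b\<^sup>2 + Q * b = 0" "P * b'\<^sup>2 + Q * b' = 0" using e(5) e'(5) that by auto
    then have "(P * b + Q) * b = 0" "(P * b' + Q) * b' = 0"
      by (simp_all add: power2_eq_square algebra_simps)
    then have PQ: "P * b = Q" "P * b' = Q" using b by (simp_all add: sum_eq_0_iff)
    then have "P = 0" using b by (metis mult_cancel_left)
    then have Q: "Q = 0" using PQ by simp
    then have "R = 0" using e(1,7) that b by (simp add: 1)
    have d: "d = p * b" "d' = p * b'" using e(6) e'(6) by (simp_all add: 1 Q)
    then have s: "s = p" using e(4) that b by simp
    have "r * b + p * b\<^sup>2 = p\<^sup>2 * b\<^sup>2" "r * b' + p * b'\<^sup>2 = p\<^sup>2 * b'\<^sup>2"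
      using e(8) e'(8) by (simp_all add: d s 1 power_mult_distrib)
    then have "(r + p * b) * b = p\<^sup>2 * b * b" "(r + p * b') * b' = p\<^sup>2 * b' * b'"
      by (simp_all add: power2_eq_square algebra_simps)
    then have "r + p * b = p\<^sup>2 * b" "r + p * b' = p\<^sup>2 * b'" using b by simp_all
    then have "r = (p\<^sup>2 + p) * b" "r = (p\<^sup>2 + p) * b'"
      by (simp_all add: distrib_right) (metis add.assoc add.right_neutral double_zero(1))+
    then have "r = 0" using b by (metis mult_cancel_left mult_zero_left)
    then show ?thesis using 1 Q s \<open>P = 0\<close> \<open>R = 0\<close> by simp
  qed
  show a: "a \<noteq> 0" and a': "a' \<noteq> 0"
    using mixed[of b c d a' b' c' d'] mixed[of b' c' d' a b c d] vertical T T' b nonscalar by blast+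
  note off = intertwines_coeffs_off_axes[OF T a b(1)]
    and off' = intertwines_coeffs_off_axes[OF T' a' b(2)]
  show l: "(a * b)\<^sup>2 = (a' * b')\<^sup>2"
  proof (rule ccontr)
    assume neq: "(a * b)\<^sup>2 \<noteq> (a' * b')\<^sup>2"
    have "P = 0" "S = 0" using off(2,3) off'(2,3) neq by (metis mult_cancel_left)+
    then have 1: "q = 0" "r = 0" using off by simp_all
    have "s + R * (a * b)\<^sup>2 = s + R * (a' * b')\<^sup>2" using off(5) off'(5) 1 by simp
    then have "R = 0" using neq by simp
    then show False using nonscalar off(1,5) 1 \<open>P = 0\<close> \<open>S = 0\<close> by simp
  qed
  then have ab: "a * b = a' * b'" by (metis square_square)
  \<comment> \<open>As \<open>b \<noteq> b'\<close> but \<open>a b = a' b'\<close>, also \<open>a \<noteq> a'\<close>.\<close>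
  then have "a * b * a \<noteq> a' * b' * a'" using a b by auto
  moreover have "S * (a * b * a) = S * (a' * b' * a')" using off(4) off'(4) unfolding l by (metis add_left_cancel)
  ultimately have "S = 0" by (metis mult_cancel_left)
  then have "q * b = 0" using off(4,5) by simp
  then have "q = 0" using b by simp
  then show "c = p * a" "d = p * b" "c' = p * a'" "d' = p * b'"
    using e(1,6) e'(1,6) off(1) by simp_all
qed

section \<open>The orbits of the exceptional pairs\<close>

lemma pair_orbit_diagonal:
  assumes "x \<noteq> 0" shows "pair_orbit (amult \<sigma>) x x = {(z, z) | z. True}"
proof -
  have "\<exists>v. z = amult \<sigma> v x" for z
    using surjD[OF bij_is_surj[OF bij_right_mult[OF assms]], of z] by blast
  then show ?thesis by (auto simp: pair_orbit_def)
qed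

lemma pair_orbit_scalar:
  assumes "a \<noteq> 0"
  shows "pair_orbit (amult \<sigma>) (a, 0) (k * a, 0) = {((u, w), (k * u, k * w)) | u w. True}"
    (is "_ = ?graph")
proof
  show "pair_orbit (amult \<sigma>) (a, 0) (k * a, 0) \<subseteq> ?graph"
    by (auto simp: pair_orbit_def amult_pair)
  have "((u, w), (k * u, k * w)) = (amult \<sigma> (u * a\<^sup>2, w * a\<^sup>2) (a, 0), amult \<sigma> (u * a\<^sup>2, w * a\<^sup>2) (k * a, 0))"
    for u w using cube_eq_1[OF assms] by (simp add: amult_pair ac_simps)
  then show "?graph \<subseteq> pair_orbit (amult \<sigma>) (a, 0) (k * a, 0)"
    unfolding pair_orbit_def by blast
qed

text \<open>For \<open>v = (f, g)\<close> the first coordinate of \<open>v x\<close> is \<open>u = f a + g\<^sup>2 b\<close>, and the second one is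
  \<open>l\<^sup>2 u\<^sup>2 + w\<close> with \<open>w = l a g\<^sup>2\<close>. For \<open>t x\<close> in place of \<open>x\<close> the parameters \<open>l\<close>, \<open>u\<close> and \<open>w\<close> become
  \<open>t l\<close>, \<open>t u\<close> and \<open>t\<^sup>2 w\<close>. Since \<open>(u, w)\<close> runs through \<open>E\<^sup>2\<close>, the orbit depends on \<open>l\<close> and \<open>t\<close>
  only, and not on the point \<open>(a, b)\<close> of the plane.\<close>

lemma pair_orbit_twisted_plane:
  assumes a: "a \<noteq> 0" and l: "l \<noteq> 0" and b: "a\<^sup>2 = l * b" "b\<^sup>2 = l * a"
  shows "pair_orbit (amult \<sigma>) (a, b) (t * a, t * b) =
    {((u, l\<^sup>2 * u\<^sup>2 + w), (t * u, t * (l\<^sup>2 * u\<^sup>2) + t\<^sup>2 * w)) | u w. True}" (is "_ = ?graph")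
proof -
  have b': "b = (l * a)\<^sup>2" using b(2) by (metis square_square)
  have eq: "amult \<sigma> (f, g) (t * a, t * b) = (t * u, t * (l\<^sup>2 * u\<^sup>2) + t\<^sup>2 * w)"
    if "u = f * a + g\<^sup>2 * b" "w = g\<^sup>2 * (l * a)" for f g u w t
  proof -
    have "l\<^sup>2 * u\<^sup>2 = f\<^sup>2 * (l\<^sup>2 * a\<^sup>2) + g * (l\<^sup>2 * b\<^sup>2)"
      by (simp add: that square_add power_mult_distrib algebra_simps)
    also have "l\<^sup>2 * a\<^sup>2 = b" by (simp add: b' power_mult_distrib)
    also have "l\<^sup>2 * b\<^sup>2 = (l * l\<^sup>2) * a" unfolding b(2) by (simp only: ac_simps)
    also have "\<dots> = a" by (simp only: cube_eq_1[OF l] mult_1_left)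
    finally show ?thesis
      by (simp add: amult_pair that power_mult_distrib b(2) algebra_simps)
  qed
  have param: "(amult \<sigma> (f, g) (a, b), amult \<sigma> (f, g) (t * a, t * b)) =
      ((u, l\<^sup>2 * u\<^sup>2 + w), (t * u, t * (l\<^sup>2 * u\<^sup>2) + t\<^sup>2 * w))"
    if "u = f * a + g\<^sup>2 * b" "w = g\<^sup>2 * (l * a)" for f g u w
    using eq[OF that, of 1] eq[OF that, of t] by simp
  show ?thesis
  proof (intro equalityI subsetI)
    fix z assume "z \<in> pair_orbit (amult \<sigma>) (a, b) (t * a, t * b)"
    then obtain f g where "z = (amult \<sigma> (f, g) (a, b), amult \<sigma> (f, g) (t * a, t * b))"
      unfolding pair_orbit_def by auto
    then show "z \<in> ?graph" using param[OF refl refl, of f g] by blast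
  next
    fix z assume "z \<in> ?graph"
    then obtain u w where z: "z = ((u, l\<^sup>2 * u\<^sup>2 + w), (t * u, t * (l\<^sup>2 * u\<^sup>2) + t\<^sup>2 * w))"
      by blast
    \<comment> \<open>Solve \<open>w = l a g\<^sup>2\<close> for \<open>g\<close> (square roots are squares), then \<open>u = f a + g\<^sup>2 b\<close> for \<open>f\<close>.\<close>
    define g where "g = (w * (l * a)\<^sup>2)\<^sup>2"
    define f where "f = (u + g\<^sup>2 * b) * a\<^sup>2"
    have "g\<^sup>2 * (l * a) = w * ((l * a) * (l * a)\<^sup>2)"
      unfolding g_def square_square by (simp only: ac_simps)
    then have w: "w = g\<^sup>2 * (l * a)" using cube_eq_1[of "l * a"] a l by simp
    have "f * a = (u + g\<^sup>2 * b) * (a * a\<^sup>2)" unfolding f_def by (simp only: ac_simps)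
    then have "u = f * a + g\<^sup>2 * b" by (simp only: cube_eq_1[OF a] mult_1_right add.assoc double_zero(1) add_0_right)
    from param[OF this w] show "z \<in> pair_orbit (amult \<sigma>) (a, b) (t * a, t * b)"
      unfolding z pair_orbit_def by (metis (mono_tags, lifting) mem_Collect_eq)
  qed
qed

section \<open>Classification of equal orbits\<close>

text \<open>The pairs \<open>(x, y)\<close> with \<open>T R\<^sub>x = R\<^sub>y\<close> are closed under addition. So two points with the same
  second coordinate \<open>b = b'\<close> can be traded for one of them and their sum, which lies on the axis
  \<open>b = 0\<close>.\<close>

lemma intertwines_dichotomy:
  assumes T: "intertwines (amult \<sigma>) (semilinear_map p q r s P Q R S) (a, b) (c, d)"
    and T': "intertwines (amult \<sigma>) (semilinear_map p q r s P Q R S) (a', b') (c', d')"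
    and x: "(a, b) \<noteq> (0, 0)" and x': "(a', b') \<noteq> (0, 0)" and neq: "(a, b) \<noteq> (a', b')"
  obtains (scalar) "semilinear_map p q r s P Q R S = semilinear_map p 0 0 p 0 0 0 0"
  | (twisted) "a \<noteq> 0" "b \<noteq> 0" "a' \<noteq> 0" "b' \<noteq> 0" "(a * b)\<^sup>2 = (a' * b')\<^sup>2"
    "c = p * a" "d = p * b" "c' = p * a'" "d' = p * b'"
proof (cases "b = 0 \<or> b' = 0 \<or> b = b'")
  case True
  then have "semilinear_map p q r s P Q R S = semilinear_map p 0 0 p 0 0 0 0"
  proof (elim disjE)
    assume "b = 0"
    then show ?thesis
      using intertwines_axis_imp_scalar[of p q r s P Q R S a c d a' b' c' d'] T T' x x' neq by auto
  next
    assume "b' = 0"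
    then show ?thesis
      using intertwines_axis_imp_scalar[of p q r s P Q R S a' c' d' a b c d] T T' x x' neq by auto
  next
    assume eq: "b = b'"
    then have "a + a' \<noteq> 0" using neq sum_eq_0_iff[of a a'] by simp
    moreover have "intertwines (amult \<sigma>) (semilinear_map p q r s P Q R S) (a + a', 0) (c + c', d + d')"
      using intertwines_add[OF T T'] by (simp add: eq)
    moreover have "(a, b) \<noteq> (a + a', 0)" using x' eq by auto
    ultimately show ?thesis
      using intertwines_axis_imp_scalar[OF _ T] x by blast
  qed
  then show ?thesis by (rule scalar)
next
  case False
  then show ?thesis
    using intertwines_off_axis[OF T T'] scalar twisted by blast
qed

lemma pair_orbit_eq_cases:
  assumes eq: "pair_orbit (amult \<sigma>) (a, b) (c, d) = pair_orbit (amult \<sigma>) (a', b') (c', d')"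
    and nonzero: "(a, b) \<noteq> (0, 0)" "(c, d) \<noteq> (0, 0)" "(a', b') \<noteq> (0, 0)"
    and neq: "(a, b) \<noteq> (a', b')"
  obtains (diagonal) "(c, d) = (a, b)" "(c', d') = (a', b')"
  | (scalar) k where "k \<noteq> 0" "b = 0" "b' = 0" "c = k * a" "d = 0" "c' = k * a'" "d' = 0"
  | (twisted) t where "t \<noteq> 0" "a \<noteq> 0" "b \<noteq> 0" "a' \<noteq> 0" "b' \<noteq> 0" "(a * b)\<^sup>2 = (a' * b')\<^sup>2"
    "c = t * a" "d = t * b" "c' = t * a'" "d' = t * b'"
proof -
  have "(a, b) \<noteq> 0" using nonzero by (simp add: zero_prod_def)
  from pair_orbit_graph[OF this] obtain T where add: "\<And>z u. T (z + u) = T z + T u"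
    and graph: "pair_orbit (amult \<sigma>) (a, b) (c, d) = {(z, T z) | z. True}" by blast
  have "(amult \<sigma> v (a, b), amult \<sigma> v (c, d)) \<in> pair_orbit (amult \<sigma>) (a, b) (c, d)"
    "(amult \<sigma> v (a', b'), amult \<sigma> v (c', d')) \<in> pair_orbit (amult \<sigma>) (a', b') (c', d')" for v
    unfolding pair_orbit_def by blast+
  moreover have "T z = u" if "(z, u) \<in> pair_orbit (amult \<sigma>) (a, b) (c, d)" for z u
    using that unfolding graph by blast
  ultimately have T: "intertwines (amult \<sigma>) T (a, b) (c, d)" "intertwines (amult \<sigma>) T (a', b') (c', d')"
    unfolding intertwines_def eq[symmetric] by blast+
  obtain p q r s P Q R S where "T = semilinear_map p q r s P Q R S"
    using additive_imp_semilinear_map[OF add] by blast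
  note T = T[unfolded this]
  from T nonzero(1,3) neq show ?thesis
  proof (cases rule: intertwines_dichotomy)
    case scal: scalar
    note scaled = scalar_intertwines[OF T(1)[unfolded scal]] scalar_intertwines[OF T(2)[unfolded scal]]
    have p: "p \<noteq> 0" using scaled nonzero(2) by auto
    show ?thesis
    proof (cases "b = 0 \<and> b' = 0")
      case True
      then show ?thesis using scalar[OF p] scaled by auto
    next
      case False
      then have "p = 1" using scaled p by blast
      then show ?thesis using diagonal scaled by simp
    qed
  next
    case tw: twisted
    then have "p \<noteq> 0" using nonzero(2) by auto
    from this tw show ?thesis by (rule twisted)
  qed
qed

end

theorem theorem1:
  fixes \<sigma> :: "'e::field \<Rightarrow> 'e"
    and x y x' y' :: "'e \<times> 'e"
    and a b c d a' b' c' d' :: 'e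
  assumes "CARD('e) = 4"
    and "field_automorphism \<sigma>" and "\<sigma> \<noteq> id"
    and "x \<noteq> 0" and "y \<noteq> 0" and "x' \<noteq> 0" and "y' \<noteq> 0"
    and "x = (a, b)" and "y = (c, d)" and "x' = (a', b')" and "y' = (c', d')"
  shows "pair_orbit (amult \<sigma>) x y = pair_orbit (amult \<sigma>) x' y' \<longleftrightarrow>
    (x = y \<and> x' = y') \<or>
    (x = x' \<and> y = y') \<or>
    (b = 0 \<and> d = 0 \<and> b' = 0 \<and> d' = 0 \<and> (\<exists>k. k \<noteq> 0 \<and> c = k * a \<and> c' = k * a')) \<or>
    (\<exists>l m t. l \<noteq> 0 \<and> m \<noteq> 0 \<and> t \<noteq> 0 \<and>
       \<sigma> a = l * b \<and> \<sigma> b = l * a \<and> \<sigma> a' = l * b' \<and> \<sigma> b' = l * a' \<and>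
       \<sigma> c = m * d \<and> \<sigma> d = m * c \<and> \<sigma> c' = m * d' \<and> \<sigma> d' = m * c' \<and>
       c = t * a \<and> d = t * b \<and> c' = t * a' \<and> d' = t * b')"
    (is "?eq \<longleftrightarrow> ?i \<or> ?ii \<or> ?iii \<or> ?iv")
proof
  note E = assms(1-3)
  note coords = assms(8-11)
  note sq = \<sigma>_square[OF E] and cube = cube_eq_1[OF E]
  have nonzero: "(a, b) \<noteq> (0, 0)" "(c, d) \<noteq> (0, 0)" "(a', b') \<noteq> (0, 0)"
    using assms(4-6) by (auto simp: coords zero_prod_def)
  {
    assume eq: ?eq
    show "?i \<or> ?ii \<or> ?iii \<or> ?iv"
    proof (cases "x = x'")
      case True
      obtain T where T: "pair_orbit (amult \<sigma>) x y = {(z, T z) | z. True}"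
        using pair_orbit_graph[OF E assms(4)] by blast
      have "(x, y) \<in> pair_orbit (amult \<sigma>) x y" "(x', y') \<in> pair_orbit (amult \<sigma>) x' y'"
        unfolding pair_orbit_def using amult_one[OF E] by (metis (mono_tags, lifting) mem_Collect_eq)+
      then have "y = T x" "y' = T x'" using T eq by auto
      then show ?thesis using True by simp
    next
      case False
      then have neq: "(a, b) \<noteq> (a', b')" by (simp add: coords)
      from E eq[unfolded coords] nonzero neq show ?thesis
      proof (cases rule: pair_orbit_eq_cases)
        case diagonal
        then show ?thesis by (simp add: coords)
      next
        case (scalar k)
        then show ?thesis by blast
      next
        case (twisted t)
        \<comment> \<open>The condition \<open>a\<^sup>2 = l b\<close> leaves no choice, because \<open>b\<^sup>2\<close> is the inverse of \<open>b\<close>; and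
          replacing \<open>x\<close> by \<open>t x\<close> multiplies \<open>l\<close> by \<open>t\<close>, so \<open>m = t l\<close>.\<close>
        define l where "l = (a * b)\<^sup>2"
        have l: "f\<^sup>2 = l * g" "g\<^sup>2 = l * f" if "l = (f * g)\<^sup>2" "f \<noteq> 0" "g \<noteq> 0" for f g :: 'e
        proof -
          have "l * g = f\<^sup>2 * (g * g\<^sup>2)" "l * f = g\<^sup>2 * (f * f\<^sup>2)"
            by (simp_all only: that(1) power_mult_distrib ac_simps)
          then show "f\<^sup>2 = l * g" "g\<^sup>2 = l * f"
            by (simp_all only: cube[OF that(2)] cube[OF that(3)] mult_1_right)
        qed
        note ll = l[OF l_def twisted(2,3)] l[OF l_def[unfolded twisted(6)] twisted(4,5)]
        have m: "(t * f)\<^sup>2 = (t * l) * (t * g)" if "f\<^sup>2 = l * g" for f g :: 'e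
          unfolding power_mult_distrib that by (simp add: power2_eq_square)
        have "l \<noteq> 0" "t * l \<noteq> 0" using twisted by (simp_all add: l_def)
        then have ?iv
          using twisted(1) ll m
          unfolding sq twisted(7-10) by blast
        then show ?thesis by blast
      qed
    qed
  }
  show ?eq if "?i \<or> ?ii \<or> ?iii \<or> ?iv"
    using that
  proof (elim disjE)
    assume ?i
    then show ?eq using pair_orbit_diagonal[OF E] assms(4,6) by simp
  next
    assume ?ii
    then show ?eq by simp
  next
    assume ?iii
    then show ?eq using pair_orbit_scalar[OF E] nonzero by (auto simp: coords)
  next
    assume ?iv
    then obtain l m t where l: "l \<noteq> 0"
      and b: "a\<^sup>2 = l * b" "b\<^sup>2 = l * a" "a'\<^sup>2 = l * b'" "b'\<^sup>2 = l * a'"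
      and y: "c = t * a" "d = t * b" "c' = t * a'" "d' = t * b'"
      unfolding sq by blast
    have "a \<noteq> 0" "a' \<noteq> 0" using nonzero b l by auto
    then show ?eq
      unfolding coords y using pair_orbit_twisted_plane[OF E _ l] b by simp
  qed
qed

end
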